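(* Let $\mathbf{T}=(T_1,\dots,T_n)$ be a commuting $n$-tuple of bounded linear operators on a Hilbert space $\mathcal{H}$. If $(X,\mathbf{U})$ is a unitary asymptote of $\mathbf{T}$, then $(X,\mathbf{U})$ is minimal.
   Context: Let $n\in\mathbb{N}$. Hilbert spaces are complex and may be $\{0\}$; $\mathcal{H}$ is separable; operators and transformations are bounded and linear. For commuting $n$-tuples $\mathbf{T}=(T_1,\dots,T_n)$ on $\mathcal{H}$ and $\widetilde{\mathbf{T}}=(\widetilde T_1,\dots,\widetilde T_n)$ on $\widetilde{\mathcal{H}}$, the intertwining set $\mathcal{I}(\mathbf{T},\widetilde{\mathbf{T}})$ consists of all bounded linear $X\colon\mathcal{H}\to\widetilde{\mathcal{H}}$ with $XT_i=\widetilde T_iX$ for $1\le i\le n$. A unitary intertwining pair of $\mathbf{T}$ is a pair $(X,\mathbf{U})$, where $\mathbf{U}=(U_1,\dots,U_n)$ is a commuting $n$-tuple of unitary operators on some Hilbert space $\mathcal{K}$ and $X\in\mathcal{I}(\mathbf{T},\mathbf{U})$. A unitary intertwining pair $(X,\mathbf{U})$ of $\mathbf{T}$ is a unitary asymptote of $\mathbf{T}$ if for every unitary intertwining pair $(X',\mathbf{U}')$ of $\mathbf{T}$ there exists a unique $Y'\in\mathcal{I}(\mathbf{U},\mathbf{U}')$ with $X'=Y'X$. For $\mathbf{k}=(k_1,\dots,k_n)\in\mathbb{Z}^n$, $\mathbf{U}^{\mathbf{k}}=U_1^{k_1}\cdots U_n^{k_n}$. The pair $(X,\mathbf{U})$,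 with $\mathbf{U}$ acting on $\mathcal{K}$, is minimal if the closed linear span $\bigvee\{\mathbf{U}^{\mathbf{k}}X\mathcal{H}:\mathbf{k}\in\mathbb{Z}^n\}$ equals $\mathcal{K}$. *)

theory Defs
  imports
    "HOL-Algebra.Module"
    "HOL-Algebra.Bij"
    "HOL-Analysis.Abstract_Metric_Spaces"
begin

section \<open>Complex Hilbert spaces with explicit carriers\<close>

text \<open>
  A universal property quantifies over Hilbert spaces, which HOL cannot do over types.  A Hilbert
  space is therefore a structure on a carrier set, extending the modules of HOL-Algebra; the
  ring-multiplication fields inherited by the record \<open>module\<close> are unused.
\<close>

record 'a hilbert_structure = "(complex, 'a) module" +
  cinner :: "'a \<Rightarrow> 'a \<Rightarrow> complex"

definition complex_ring :: "complex ring" where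
  "complex_ring = \<lparr>carrier = UNIV, mult = (*), one = 1, zero = 0, add = (+)\<rparr>"

definition hnorm :: "'a hilbert_structure \<Rightarrow> 'a \<Rightarrow> real" where
  "hnorm H x = sqrt (Re (cinner H x x))"

text \<open>The value outside the carrier only serves the locale \<open>Metric_space\<close>, which demands
  symmetry and nonnegativity of the distance on the whole type.\<close>

definition hdist :: "'a hilbert_structure \<Rightarrow> 'a \<Rightarrow> 'a \<Rightarrow> real" where
  "hdist H x y = (if x \<in> carrier H \<and> y \<in> carrier H then hnorm H (x \<ominus>\<^bsub>H\<^esub> y) else 0)"

text \<open>The inner product is linear in its first argument.\<close>

locale complex_inner_space = Module.module complex_ring H
  for H :: "'a hilbert_structure" (structure) +
  assumes cinner_add_left:
      "\<lbrakk>x \<in> carrier H; y \<in> carrier H; z \<in> carrier H\<rbrakk> \<Longrightarrow>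
        cinner H (x \<oplus>\<^bsub>H\<^esub> y) z = cinner H x z + cinner H y z"
    and cinner_smult_left:
      "\<lbrakk>x \<in> carrier H; y \<in> carrier H\<rbrakk> \<Longrightarrow> cinner H (a \<odot>\<^bsub>H\<^esub> x) y = a * cinner H x y"
    and cinner_commute:
      "\<lbrakk>x \<in> carrier H; y \<in> carrier H\<rbrakk> \<Longrightarrow> cinner H x y = cnj (cinner H y x)"
    and cinner_pos:
      "\<lbrakk>x \<in> carrier H; x \<noteq> \<zero>\<^bsub>H\<^esub>\<rbrakk> \<Longrightarrow> 0 < Re (cinner H x x)"
begin

lemma carrier_complex_ring [simp]: "a \<in> carrier complex_ring"
  by (simp add: complex_ring_def)

lemma smult_in_carrier [simp]: "x \<in> carrier H \<Longrightarrow> a \<odot>\<^bsub>H\<^esub> x \<in> carrier H"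
  by (rule smult_closed) auto

lemma cinner_add_right:
  assumes "x \<in> carrier H" "y \<in> carrier H" "z \<in> carrier H"
  shows "cinner H z (x \<oplus>\<^bsub>H\<^esub> y) = cinner H z x + cinner H z y"
  using assms by (metis M.a_closed cinner_add_left cinner_commute complex_cnj_add)

lemma cinner_smult_right:
  assumes "x \<in> carrier H" "y \<in> carrier H"
  shows "cinner H y (a \<odot>\<^bsub>H\<^esub> x) = cnj a * cinner H y x"
  using assms by (metis cinner_commute cinner_smult_left complex_cnj_mult smult_in_carrier)

lemma complex_ring_uminus: "\<ominus>\<^bsub>complex_ring\<^esub> a = - a"
proof -
  have "a \<oplus>\<^bsub>complex_ring\<^esub> (- a) = \<zero>\<^bsub>complex_ring\<^esub>"
    by (simp add: complex_ring_def)
  then show ?thesis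
    by (metis R.minus_equality R.add.m_comm carrier_complex_ring)
qed

lemma uminus_eq_smult:
  assumes "x \<in> carrier H"
  shows "\<ominus>\<^bsub>H\<^esub> x = (- 1) \<odot>\<^bsub>H\<^esub> x"
proof -
  have "(\<ominus>\<^bsub>complex_ring\<^esub> 1) \<odot>\<^bsub>H\<^esub> x = \<ominus>\<^bsub>H\<^esub> (1 \<odot>\<^bsub>H\<^esub> x)"
    using assms by (simp add: smult_l_minus)
  moreover have "1 \<odot>\<^bsub>H\<^esub> x = x"
    using smult_one[OF assms] by (simp add: complex_ring_def)
  ultimately show ?thesis
    by (simp add: complex_ring_uminus)
qed

lemma cinner_zero_left: "y \<in> carrier H \<Longrightarrow> cinner H \<zero>\<^bsub>H\<^esub> y = 0"
  using cinner_add_left[of "\<zero>\<^bsub>H\<^esub>" "\<zero>\<^bsub>H\<^esub>" y] by simp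

lemma cinner_self_nonneg: "x \<in> carrier H \<Longrightarrow> 0 \<le> Re (cinner H x x)"
  using cinner_pos[of x] cinner_zero_left[of x] by (cases "x = \<zero>\<^bsub>H\<^esub>") auto

lemma hnorm_nonneg: "x \<in> carrier H \<Longrightarrow> 0 \<le> hnorm H x"
  by (simp add: hnorm_def cinner_self_nonneg)

lemma hnorm_sq: "x \<in> carrier H \<Longrightarrow> (hnorm H x)\<^sup>2 = Re (cinner H x x)"
  by (simp add: hnorm_def cinner_self_nonneg)

lemma hnorm_eq_0_iff: "x \<in> carrier H \<Longrightarrow> hnorm H x = 0 \<longleftrightarrow> x = \<zero>\<^bsub>H\<^esub>"
  using cinner_pos[of x] cinner_zero_left[of x] by (cases "x = \<zero>\<^bsub>H\<^esub>") (auto simp: hnorm_def)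

lemma hnorm_comb_sq:
  fixes s t :: real
  assumes "x \<in> carrier H" "y \<in> carrier H"
  shows "(hnorm H (of_real s \<odot>\<^bsub>H\<^esub> x \<oplus>\<^bsub>H\<^esub> of_real t \<odot>\<^bsub>H\<^esub> y))\<^sup>2 =
    s\<^sup>2 * (hnorm H x)\<^sup>2 + 2 * s * t * Re (cinner H x y) + t\<^sup>2 * (hnorm H y)\<^sup>2"
proof -
  have "Re (cinner H y x) = Re (cinner H x y)"
    using assms cinner_commute[of y x] by simp
  then show ?thesis
    using assms
    by (simp add: hnorm_sq cinner_add_left cinner_add_right cinner_smult_left cinner_smult_right)
      (simp add: power2_eq_square algebra_simps)
qed

lemma Re_cinner_le:
  assumes x: "x \<in> carrier H" and y: "y \<in> carrier H"
  shows "Re (cinner H x y) \<le> hnorm H x * hnorm H y"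
proof (cases "hnorm H x = 0 \<or> hnorm H y = 0")
  case True
  then have "x = \<zero>\<^bsub>H\<^esub> \<or> y = \<zero>\<^bsub>H\<^esub>"
    using x y by (simp add: hnorm_eq_0_iff)
  then have "cinner H x y = 0"
    using x y cinner_zero_left cinner_commute[of x y] by auto
  then show ?thesis
    using True by auto
next
  case False
  define a b where "a = hnorm H x" and "b = hnorm H y"
  have pos: "a * b > 0"
    using False hnorm_nonneg[OF x] hnorm_nonneg[OF y] by (simp add: a_def b_def)
  have "0 \<le> b\<^sup>2 * a\<^sup>2 + 2 * b * (- a) * Re (cinner H x y) + (- a)\<^sup>2 * b\<^sup>2"
    unfolding a_def b_def hnorm_comb_sq[OF x y, symmetric] by simp
  then have "(a * b) * Re (cinner H x y) \<le> (a * b) * (a * b)"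
    by (simp add: power2_eq_square algebra_simps)
  then show ?thesis
    unfolding a_def[symmetric] b_def[symmetric] using pos by (rule mult_left_le_imp_le)
qed

lemma hnorm_triangle:
  assumes x: "x \<in> carrier H" and y: "y \<in> carrier H"
  shows "hnorm H (x \<oplus>\<^bsub>H\<^esub> y) \<le> hnorm H x + hnorm H y"
proof (rule power2_le_imp_le)
  have one: "1 \<odot>\<^bsub>H\<^esub> z = z" if "z \<in> carrier H" for z
    using smult_one[OF that] by (simp add: complex_ring_def)
  have "(hnorm H (x \<oplus>\<^bsub>H\<^esub> y))\<^sup>2 =
      (hnorm H x)\<^sup>2 + 2 * Re (cinner H x y) + (hnorm H y)\<^sup>2"
    using hnorm_comb_sq[OF x y, of 1 1] x y by (simp add: one)
  then show "(hnorm H (x \<oplus>\<^bsub>H\<^esub> y))\<^sup>2 \<le> (hnorm H x + hnorm H y)\<^sup>2"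
    using Re_cinner_le[OF x y] by (simp add: power2_sum)
  show "0 \<le> hnorm H x + hnorm H y"
    using x y by (simp add: hnorm_nonneg)
qed

lemma hnorm_uminus: "x \<in> carrier H \<Longrightarrow> hnorm H (\<ominus>\<^bsub>H\<^esub> x) = hnorm H x"
  by (simp add: uminus_eq_smult hnorm_def cinner_smult_left cinner_smult_right)

lemma Metric_space_hdist: "Metric_space (carrier H) (hdist H)"
proof
  fix x y z
  show "0 \<le> hdist H x y"
    by (simp add: hdist_def hnorm_nonneg)
  show "hdist H x y = hdist H y x"
  proof (cases "x \<in> carrier H \<and> y \<in> carrier H")
    case True
    then have "\<ominus>\<^bsub>H\<^esub> (x \<ominus>\<^bsub>H\<^esub> y) = y \<ominus>\<^bsub>H\<^esub> x"
      by (simp add: a_minus_def M.minus_add M.a_comm)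
    then show ?thesis
      using True hnorm_uminus[of "x \<ominus>\<^bsub>H\<^esub> y"] by (simp add: hdist_def)
  qed (auto simp: hdist_def)
  show "hdist H x y = 0 \<longleftrightarrow> x = y" if "x \<in> carrier H" "y \<in> carrier H"
  proof -
    have "x \<ominus>\<^bsub>H\<^esub> y = \<zero>\<^bsub>H\<^esub> \<longleftrightarrow> x = y"
      using that by (metis M.minus_equality M.minus_minus M.r_neg M.a_inv_closed a_minus_def)
    then show ?thesis
      using that by (simp add: hdist_def hnorm_eq_0_iff)
  qed
  show "hdist H x z \<le> hdist H x y + hdist H y z"
    if "x \<in> carrier H" "y \<in> carrier H" "z \<in> carrier H"
  proof -
    have "x \<ominus>\<^bsub>H\<^esub> z = (x \<ominus>\<^bsub>H\<^esub> y) \<oplus>\<^bsub>H\<^esub> (y \<ominus>\<^bsub>H\<^esub> z)"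
      using that by (simp add: a_minus_def M.a_assoc M.r_neg2 M.r_neg1)
    then show ?thesis
      using that hnorm_triangle[of "x \<ominus>\<^bsub>H\<^esub> y" "y \<ominus>\<^bsub>H\<^esub> z"] by (simp add: hdist_def)
  qed
qed

end

sublocale complex_inner_space \<subseteq> Metric_space "carrier H" "hdist H"
  by (rule Metric_space_hdist)

locale hilbert_space = complex_inner_space +
  assumes complete: mcomplete

definition htopology :: "'a hilbert_structure \<Rightarrow> 'a topology" where
  "htopology H = Metric_space.mtopology (carrier H) (hdist H)"

definition closed_linear_span :: "'a hilbert_structure \<Rightarrow> 'a set \<Rightarrow> 'a set" where
  "closed_linear_span H S =
    htopology H closure_of ((\<lambda>N. submodule N complex_ring H) hull S)"


section \<open>Bounded operators\<close>

text \<open>Transformations are extensional functions on the carrier, so that they are equal iff they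
  agree on the carrier, and products of transformations are formed by \<open>compose\<close>.\<close>

definition bounded_ops ::
    "'a hilbert_structure \<Rightarrow> 'b hilbert_structure \<Rightarrow> ('a \<Rightarrow> 'b) set" where
  "bounded_ops H K = {X \<in> carrier H \<rightarrow>\<^sub>E carrier K.
    (\<forall>x\<in>carrier H. \<forall>y\<in>carrier H. X (x \<oplus>\<^bsub>H\<^esub> y) = X x \<oplus>\<^bsub>K\<^esub> X y) \<and>
    (\<forall>a. \<forall>x\<in>carrier H. X (a \<odot>\<^bsub>H\<^esub> x) = a \<odot>\<^bsub>K\<^esub> X x) \<and>
    (\<exists>C. \<forall>x\<in>carrier H. hnorm K (X x) \<le> C * hnorm H x)}"

text \<open>The witness \<open>V\<close> is the adjoint of \<open>U\<close>.\<close>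

definition unitary_op :: "'a hilbert_structure \<Rightarrow> ('a \<Rightarrow> 'a) \<Rightarrow> bool" where
  "unitary_op K U \<longleftrightarrow> U \<in> bounded_ops K K \<and>
    (\<exists>V\<in>bounded_ops K K.
      (\<forall>x\<in>carrier K. \<forall>y\<in>carrier K. cinner K (U x) y = cinner K x (V y)) \<and>
      compose (carrier K) V U = (\<lambda>x\<in>carrier K. x) \<and>
      compose (carrier K) U V = (\<lambda>x\<in>carrier K. x))"


section \<open>Unitary asymptotes\<close>

text \<open>An \<open>n\<close>-tuple is a family indexed by \<open>nat\<close>, of which only the members with index in
  \<open>{1..n}\<close> are relevant.\<close>

definition commuting_tuple :: "nat \<Rightarrow> 'a hilbert_structure \<Rightarrow> (nat \<Rightarrow> 'a \<Rightarrow> 'a) \<Rightarrow> bool" where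
  "commuting_tuple n H T \<longleftrightarrow>
    (\<forall>i\<in>{1..n}. T i \<in> bounded_ops H H) \<and>
    (\<forall>i\<in>{1..n}. \<forall>j\<in>{1..n}. compose (carrier H) (T i) (T j) = compose (carrier H) (T j) (T i))"

definition intertwiners ::
    "nat \<Rightarrow> 'a hilbert_structure \<Rightarrow> (nat \<Rightarrow> 'a \<Rightarrow> 'a) \<Rightarrow>
      'b hilbert_structure \<Rightarrow> (nat \<Rightarrow> 'b \<Rightarrow> 'b) \<Rightarrow> ('a \<Rightarrow> 'b) set" where
  "intertwiners n H T K S = {X \<in> bounded_ops H K.
    \<forall>i\<in>{1..n}. compose (carrier H) X (T i) = compose (carrier H) (S i) X}"

definition unitary_intertwining_pair ::
    "nat \<Rightarrow> 'a hilbert_structure \<Rightarrow> (nat \<Rightarrow> 'a \<Rightarrow> 'a) \<Rightarrow>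
      'b hilbert_structure \<Rightarrow> ('a \<Rightarrow> 'b) \<Rightarrow> (nat \<Rightarrow> 'b \<Rightarrow> 'b) \<Rightarrow> bool" where
  "unitary_intertwining_pair n H T K X U \<longleftrightarrow>
    hilbert_space K \<and> commuting_tuple n K U \<and> (\<forall>i\<in>{1..n}. unitary_op K (U i)) \<and>
    X \<in> intertwiners n H T K U"

text \<open>
  The pairs \<open>(X', U')\<close> range over all Hilbert spaces \<open>K'\<close> whose carrier is a subset of the type
  \<open>'b\<close> that also contains the carrier of \<open>K\<close>.  Assuming the universal property is thus never
  stronger than assuming it for the class of all Hilbert spaces.
  For separable \<open>H\<close> and a type \<open>'b\<close> with at least continuum many elements the two agree:
  testing against \<open>K' = K\<close> already gives minimality, hence uniqueness of \<open>Y'\<close> for every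
  \<open>K'\<close>, and the range of \<open>X'\<close> generates a separable reducing subspace of \<open>K'\<close>, which is
  unitarily equivalent to a Hilbert space on a subset of \<open>'b\<close>, so existence of \<open>Y'\<close> carries
  over.
\<close>

definition unitary_asymptote ::
    "nat \<Rightarrow> 'a hilbert_structure \<Rightarrow> (nat \<Rightarrow> 'a \<Rightarrow> 'a) \<Rightarrow>
      'b hilbert_structure \<Rightarrow> ('a \<Rightarrow> 'b) \<Rightarrow> (nat \<Rightarrow> 'b \<Rightarrow> 'b) \<Rightarrow> bool" where
  "unitary_asymptote n H T K X U \<longleftrightarrow>
    unitary_intertwining_pair n H T K X U \<and>
    (\<forall>(K' :: 'b hilbert_structure) X' U'. unitary_intertwining_pair n H T K' X' U' \<longrightarrow>
      (\<exists>!Y'. Y' \<in> intertwiners n K U K' U' \<and> X' = compose (carrier H) Y' X))"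

text \<open>The product \<open>U\<^sub>1\<^bsup>k\<^sub>1\<^esup> \<cdots> U\<^sub>n\<^bsup>k\<^sub>n\<^esup>\<close>, formed in the group of bijections of the carrier, whose
  multiplication is \<open>compose\<close>; unitary operators belong to this group.\<close>

definition multi_power ::
    "nat \<Rightarrow> 'a hilbert_structure \<Rightarrow> (nat \<Rightarrow> 'a \<Rightarrow> 'a) \<Rightarrow> (nat \<Rightarrow> int) \<Rightarrow> 'a \<Rightarrow> 'a" where
  "multi_power n K U k =
    foldr (\<lambda>i V. (U i [^]\<^bsub>BijGroup (carrier K)\<^esub> k i) \<otimes>\<^bsub>BijGroup (carrier K)\<^esub> V)
      [1..<Suc n] \<one>\<^bsub>BijGroup (carrier K)\<^esub>"

definition minimal_pair ::
    "nat \<Rightarrow> 'a hilbert_structure \<Rightarrow> 'b hilbert_structure \<Rightarrow> ('a \<Rightarrow> 'b) \<Rightarrow> (nat \<Rightarrow> 'b \<Rightarrow> 'b) \<Rightarrow> bool"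
  where
  "minimal_pair n H K X U \<longleftrightarrow>
    closed_linear_span K (\<Union>k. multi_power n K U k ` X ` carrier H) = carrier K"

end

theory Submission
  imports Defs
begin

text \<open>
  Let \<open>L\<close> be the closed linear span of the \<open>U\<^sup>k X H\<close>.  It is a reducing subspace for every
  \<open>U\<^sub>i\<close>, so \<open>X\<close>, with values in \<open>L\<close>, and the restrictions of the \<open>U\<^sub>i\<close> to \<open>L\<close> form a unitary
  intertwining pair; hence \<open>X\<close> factors as \<open>Y' X\<close> with \<open>Y' : K \<rightarrow> L\<close>.  As an operator on \<open>K\<close>, both
  \<open>Y'\<close> and the identity factor \<open>X\<close> through itself; by uniqueness \<open>Y'\<close> is the identity, and \<open>K = L\<close>.
  No orthogonal projection is needed.
\<close>

section \<open>Products of powers of commuting group elements\<close>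

text \<open>Natural powers of \<open>x\<close> commute with \<open>y\<close> by
  \<open>group_commutes_pow\<close>. An element that commutes with \<open>y\<close> has an inverse
  that does so too, which settles negative exponents.\<close>

lemma (in group) int_pow_commute:
  assumes "x \<otimes> y = y \<otimes> x" "x \<in> carrier G" "y \<in> carrier G"
  shows "x [^] (e::int) \<otimes> y = y \<otimes> x [^] e"
proof (cases e rule: int_cases2)
  case (nonneg m)
  then show ?thesis
    using group_commutes_pow[OF assms] by (simp add: int_pow_int)
next
  case (nonpos m)
  let ?z = "x [^] m"
  have "?z \<otimes> (y \<otimes> inv ?z) = (y \<otimes> ?z) \<otimes> inv ?z"
    using group_commutes_pow[OF assms] assms(2,3) by (simp flip: m_assoc)
  then have "inv ?z \<otimes> y = inv ?z \<otimes> (?z \<otimes> (y \<otimes> inv ?z))"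
    using assms(2,3) by (simp add: m_assoc)
  then have "inv ?z \<otimes> y = y \<otimes> inv ?z"
    using assms(2,3) by (simp flip: m_assoc)
  then show ?thesis
    using nonpos assms(2) by (simp add: int_pow_neg int_pow_int)
qed

lemma (in group) foldr_int_pow_closed:
  assumes "\<And>j. j \<in> set js \<Longrightarrow> u j \<in> carrier G"
  shows "foldr (\<lambda>j v. u j [^] (k j :: int) \<otimes> v) js \<one> \<in> carrier G"
  using assms by (induction js) auto

text \<open>The extra factor \<open>u i [^] e\<close> arises at the single position of
  \<open>i\<close> in the list and is moved to the front past the earlier factors, with which it
  commutes. This is what later makes the orbit invariant under all integer powers of
  \<open>U i\<close>.\<close>

lemma (in group) foldr_int_pow_update:
  fixes k :: "'i \<Rightarrow> int"
  assumes "distinct js" "i \<in> set js"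
    and "\<And>j. j \<in> set js \<Longrightarrow> u j \<in> carrier G"
    and "\<And>j. j \<in> set js \<Longrightarrow> u i \<otimes> u j = u j \<otimes> u i"
  shows "foldr (\<lambda>j v. u j [^] (k(i := k i + e)) j \<otimes> v) js \<one> =
    u i [^] e \<otimes> foldr (\<lambda>j v. u j [^] k j \<otimes> v) js \<one>"
  using assms
proof (induction js)
  case (Cons j js)
  let ?P = "\<lambda>k js. foldr (\<lambda>j v. u j [^] k j \<otimes> v) js \<one>"
  have cl: "u j \<in> carrier G" "?P k js \<in> carrier G"
    using Cons.prems by (auto intro: foldr_int_pow_closed)
  show ?case
  proof (cases "j = i")
    case True
    \<comment> \<open>By distinctness \<open>i\<close> does not occur in \<open>js\<close>, so the
      tail does not see the changed exponent.\<close>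
    then have "?P (k(i := k i + e)) js = ?P k js"
      using Cons.prems by (intro foldr_cong) auto
    then show ?thesis
      using True cl by (simp add: int_pow_mult add.commute[of "k i"] m_assoc)
  next
    case False
    then have i: "u i \<in> carrier G" and IH: "?P (k(i := k i + e)) js = u i [^] e \<otimes> ?P k js"
      using Cons by auto
    \<comment> \<open>\<open>int_pow_commute\<close> is used twice: first to raise
      \<open>u i\<close> to a power, then to raise \<open>u j\<close>.\<close>
    have "u i [^] e \<otimes> u j = u j \<otimes> u i [^] e"
      using Cons.prems i by (intro int_pow_commute) auto
    then have "u j [^] k j \<otimes> u i [^] e = u i [^] e \<otimes> u j [^] k j"
      using cl i by (intro int_pow_commute) auto
    then show ?thesis
      using False IH cl i by (simp flip: m_assoc)
  qed
qed simp


section \<open>Closed subspaces\<close>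

context complex_inner_space
begin

lemma hdist_eq: "x \<in> carrier H \<Longrightarrow> y \<in> carrier H \<Longrightarrow>
    hdist H x y = hnorm H (x \<oplus>\<^bsub>H\<^esub> (- 1) \<odot>\<^bsub>H\<^esub> y)"
  by (simp add: hdist_def a_minus_def uminus_eq_smult)

lemma hnorm_smult: "x \<in> carrier H \<Longrightarrow> hnorm H (a \<odot>\<^bsub>H\<^esub> x) = cmod a * hnorm H x"
proof (rule power2_eq_imp_eq)
  assume x: "x \<in> carrier H"
  have "cinner H (a \<odot>\<^bsub>H\<^esub> x) (a \<odot>\<^bsub>H\<^esub> x) = a * cnj a * cinner H x x"
    using x by (simp add: cinner_smult_left cinner_smult_right)
  also have "\<dots> = of_real ((cmod a)\<^sup>2) * cinner H x x"
    by (simp only: complex_norm_square)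
  finally show "(hnorm H (a \<odot>\<^bsub>H\<^esub> x))\<^sup>2 = (cmod a * hnorm H x)\<^sup>2"
    using x by (simp only: hnorm_sq power_mult_distrib smult_in_carrier times_complex.sel(1)
        Re_complex_of_real Im_complex_of_real mult_zero_left diff_zero)
qed (simp_all add: hnorm_nonneg)

text \<open>Closure under negation follows from closure under scalars, a negative being the multiple
  by \<open>- 1\<close>.\<close>

lemma submoduleI':
  assumes "N \<subseteq> carrier H" "\<zero>\<^bsub>H\<^esub> \<in> N"
    and "\<And>x y. x \<in> N \<Longrightarrow> y \<in> N \<Longrightarrow> x \<oplus>\<^bsub>H\<^esub> y \<in> N"
    and "\<And>a x. x \<in> N \<Longrightarrow> a \<odot>\<^bsub>H\<^esub> x \<in> N"
  shows "submodule N complex_ring H"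
  using assms by (intro submoduleI) (auto simp: uminus_eq_smult subset_iff)

lemma submodule_zero:
  assumes "submodule N complex_ring H"
  shows "\<zero>\<^bsub>H\<^esub> \<in> N"
  using subgroup.one_closed[OF submodule.axioms(1)[OF assms]] by simp

lemma submodule_smult:
  assumes "submodule N complex_ring H" "x \<in> N"
  shows "a \<odot>\<^bsub>H\<^esub> x \<in> N"
  using submoduleE(4)[OF assms(1) _ assms(2)] by simp

lemma submodule_hull:
  assumes "S \<subseteq> carrier H"
  shows "submodule ((\<lambda>N. submodule N complex_ring H) hull S) complex_ring H"
proof (rule submoduleI')
  show "(\<lambda>N. submodule N complex_ring H) hull S \<subseteq> carrier H"
    using assms carrier_is_submodule by (rule hull_minimal)
qed (auto simp: hull_def submodule_zero submodule_smult submoduleE(5))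

section \<open>Closures of linear subspaces and their images under bounded operators\<close>

lemma mem_closure_iff:
  assumes "N \<subseteq> carrier H"
  shows "x \<in> htopology H closure_of N \<longleftrightarrow>
    x \<in> carrier H \<and> (\<forall>e>0. \<exists>y\<in>N. hdist H x y < e)"
  using assms by (auto simp: htopology_def metric_closure_of subset_iff)

lemma hdist_add:
  assumes "x \<in> carrier H" "y \<in> carrier H" "x' \<in> carrier H" "y' \<in> carrier H"
  shows "hdist H (x \<oplus>\<^bsub>H\<^esub> x') (y \<oplus>\<^bsub>H\<^esub> y') \<le> hdist H x y + hdist H x' y'"
proof -
  have "(x \<oplus>\<^bsub>H\<^esub> x') \<ominus>\<^bsub>H\<^esub> (y \<oplus>\<^bsub>H\<^esub> y') = (x \<ominus>\<^bsub>H\<^esub> y) \<oplus>\<^bsub>H\<^esub> (x' \<ominus>\<^bsub>H\<^esub> y')"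
    using assms by (simp add: a_minus_def M.minus_add M.a_ac)
  then show ?thesis
    using assms hnorm_triangle[of "x \<ominus>\<^bsub>H\<^esub> y" "x' \<ominus>\<^bsub>H\<^esub> y'"] by (simp add: hdist_def)
qed

text \<open>Treating scaling as an operator makes the closure of a subspace under scalars a case of
  \<open>bounded_op_closure\<close>.\<close>

lemma smult_bounded_op: "(\<lambda>x\<in>carrier H. a \<odot>\<^bsub>H\<^esub> x) \<in> bounded_ops H H"
proof -
  have "a \<odot>\<^bsub>H\<^esub> (b \<odot>\<^bsub>H\<^esub> x) = b \<odot>\<^bsub>H\<^esub> (a \<odot>\<^bsub>H\<^esub> x)" if "x \<in> carrier H" for b x
    using smult_assoc1[of a b x] smult_assoc1[of b a x] that
    by (simp add: complex_ring_def mult.commute)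
  moreover have "\<exists>C. \<forall>x\<in>carrier H. hnorm H (a \<odot>\<^bsub>H\<^esub> x) \<le> C * hnorm H x"
    by (intro exI[of _ "cmod a"]) (simp add: hnorm_smult)
  ultimately show ?thesis
    by (auto simp: bounded_ops_def smult_r_distr)
qed

text \<open>A bounded operator is Lipschitz, so it maps approximants of \<open>x\<close> in
  \<open>N\<close> to approximants of \<open>F x\<close>, which are again in
  \<open>N\<close>.\<close>

lemma bounded_op_closure:
  assumes F: "F \<in> bounded_ops H H" and N: "N \<subseteq> carrier H" "F ` N \<subseteq> N"
    and x: "x \<in> htopology H closure_of N"
  shows "F x \<in> htopology H closure_of N"
proof -
  obtain C where C: "\<And>x. x \<in> carrier H \<Longrightarrow> hnorm H (F x) \<le> C * hnorm H x"
    using F unfolding bounded_ops_def by blast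
  have cl: "F y \<in> carrier H" if "y \<in> carrier H" for y
    using F that by (auto simp: bounded_ops_def)
  have lip: "hdist H (F y) (F z) \<le> C * hdist H y z"
    if "y \<in> carrier H" "z \<in> carrier H" for y z
    using F C[of "y \<oplus>\<^bsub>H\<^esub> (- 1) \<odot>\<^bsub>H\<^esub> z"] that cl by (simp add: hdist_eq bounded_ops_def)
  have "\<exists>y\<in>N. hdist H (F x) y < e" if "e > 0" for e
  proof -
    \<comment> \<open>The bound \<open>C\<close> may be zero or negative;
      \<open>\<bar>C\<bar> + 1\<close> is a positive Lipschitz constant by which one can
      divide.\<close>
    have "e / (\<bar>C\<bar> + 1) > 0"
      using that by simp
    then obtain y where y: "y \<in> N" "hdist H x y < e / (\<bar>C\<bar> + 1)"
      using x unfolding mem_closure_iff[OF N(1)] by blast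
    have "hdist H (F x) (F y) \<le> C * hdist H x y"
      using lip x y N(1) by (auto simp: mem_closure_iff)
    also have "\<dots> \<le> (\<bar>C\<bar> + 1) * hdist H x y"
      by (intro mult_right_mono) auto
    also have "\<dots> < e"
      using y(2) by (simp add: field_simps)
    finally show ?thesis
      using y(1) N(2) by auto
  qed
  then show ?thesis
    using x N(1) cl by (auto simp: mem_closure_iff)
qed

lemma submodule_closure:
  assumes N: "submodule N complex_ring H"
  shows "submodule (htopology H closure_of N) complex_ring H"
proof (rule submoduleI')
  note sub = submoduleE(1)[OF N]
  show "htopology H closure_of N \<subseteq> carrier H"
    using sub by (auto simp: mem_closure_iff)
  show "\<zero>\<^bsub>H\<^esub> \<in> htopology H closure_of N"
    using sub submodule_zero[OF N] by (force simp: mem_closure_iff)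
  show "a \<odot>\<^bsub>H\<^esub> x \<in> htopology H closure_of N" if "x \<in> htopology H closure_of N" for a x
  proof -
    have "(\<lambda>x\<in>carrier H. a \<odot>\<^bsub>H\<^esub> x) ` N \<subseteq> N"
      using sub submodule_smult[OF N] by auto
    then show ?thesis
      using bounded_op_closure[OF smult_bounded_op[of a] sub _ that] that
      by (simp add: mem_closure_iff[OF sub])
  qed
  show "x \<oplus>\<^bsub>H\<^esub> x' \<in> htopology H closure_of N"
    if x: "x \<in> htopology H closure_of N" and x': "x' \<in> htopology H closure_of N" for x x'
  proof -
    have "\<exists>z\<in>N. hdist H (x \<oplus>\<^bsub>H\<^esub> x') z < e" if "e > 0" for e
    proof -
      obtain y y' where y: "y \<in> N" "hdist H x y < e / 2" and y': "y' \<in> N" "hdist H x' y' < e / 2"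
        using x x' half_gt_zero[OF \<open>e > 0\<close>] unfolding mem_closure_iff[OF sub] by blast
      have "hdist H (x \<oplus>\<^bsub>H\<^esub> x') (y \<oplus>\<^bsub>H\<^esub> y') \<le> hdist H x y + hdist H x' y'"
        using x x' y y' sub by (intro hdist_add) (auto simp: mem_closure_iff)
      then show ?thesis
        using y y' submoduleE(5)[OF N, of y y'] by force
    qed
    then show ?thesis
      using x x' sub by (auto simp: mem_closure_iff)
  qed
qed

text \<open>The vectors that \<open>F\<close> maps into the hull of \<open>S\<close> form a
  submodule containing \<open>S\<close>, hence containing the hull. So the hull is invariant under
  \<open>F\<close>, and continuity carries this over to its closure.\<close>

lemma closed_linear_span_bounded_op:
  assumes S: "S \<subseteq> carrier H" and F: "F \<in> bounded_ops H H" and FS: "F ` S \<subseteq> S"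
    and x: "x \<in> closed_linear_span H S"
  shows "F x \<in> closed_linear_span H S"
proof -
  let ?N = "(\<lambda>N. submodule N complex_ring H) hull S"
  note N = submodule_hull[OF S]
  note sub = submoduleE(1)[OF N]
  have lin: "F (y \<oplus>\<^bsub>H\<^esub> z) = F y \<oplus>\<^bsub>H\<^esub> F z" "F (a \<odot>\<^bsub>H\<^esub> y) = a \<odot>\<^bsub>H\<^esub> F y" "F y \<in> carrier H"
    if "y \<in> carrier H" "z \<in> carrier H" for a y z
    using F that by (auto simp: bounded_ops_def)
  have F0: "F \<zero>\<^bsub>H\<^esub> = \<zero>\<^bsub>H\<^esub>"
    by (metis M.add.r_cancel_one' M.zero_closed M.l_zero lin(1,3))
  have "submodule {y \<in> carrier H. F y \<in> ?N} complex_ring H"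
    by (rule submoduleI')
      (auto simp: lin F0 submodule_zero[OF N] submodule_smult[OF N] submoduleE(5)[OF N])
  moreover have "S \<subseteq> {y \<in> carrier H. F y \<in> ?N}"
    using S FS by (auto intro: hull_inc)
  ultimately have "?N \<subseteq> {y \<in> carrier H. F y \<in> ?N}"
    by (intro hull_minimal)
  then show ?thesis
    using bounded_op_closure[OF F sub, of x] x by (auto simp: closed_linear_span_def)
qed

lemma closed_linear_span_superset:
  assumes "S \<subseteq> carrier H"
  shows "S \<subseteq> closed_linear_span H S"
proof -
  let ?N = "(\<lambda>N. submodule N complex_ring H) hull S"
  have "?N \<subseteq> htopology H closure_of ?N"
    using submoduleE(1)[OF submodule_hull[OF assms]]
    by (intro closure_of_subset) (simp add: htopology_def)
  then show ?thesis
    unfolding closed_linear_span_def using hull_subset[of S] by blast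
qed

lemma submodule_closed_linear_span:
  "S \<subseteq> carrier H \<Longrightarrow> submodule (closed_linear_span H S) complex_ring H"
  unfolding closed_linear_span_def by (intro submodule_closure submodule_hull)

lemma closedin_closed_linear_span: "closedin (htopology H) (closed_linear_span H S)"
  by (simp add: closed_linear_span_def)

section \<open>Closed subspaces as Hilbert spaces\<close>

lemma complex_inner_space_submodule:
  assumes "submodule N complex_ring H"
  shows "complex_inner_space (H\<lparr>carrier := N\<rparr>)"
proof -
  have "Module.module complex_ring (H\<lparr>carrier := N\<rparr>)"
    using assms module_axioms by (rule submodule.submodule_is_module)
  moreover have "complex_inner_space_axioms (H\<lparr>carrier := N\<rparr>)"
  proof
    show "cinner (H\<lparr>carrier := N\<rparr>) x y = cnj (cinner (H\<lparr>carrier := N\<rparr>) y x)"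
      if "x \<in> carrier (H\<lparr>carrier := N\<rparr>)" "y \<in> carrier (H\<lparr>carrier := N\<rparr>)" for x y
      using that submoduleE(1)[OF assms] cinner_commute[of x y] by auto
  qed (use submoduleE(1)[OF assms] in
      \<open>auto simp: subset_iff cinner_add_left cinner_smult_left cinner_pos\<close>)
  ultimately show ?thesis
    by (rule complex_inner_space.intro)
qed

end

lemma hnorm_carrier_update [simp]: "hnorm (H\<lparr>carrier := N\<rparr>) = hnorm H"
  by (simp add: hnorm_def fun_eq_iff)

text \<open>Subtraction in a module depends on the carrier, since additive inverses are sought
  there. Rewriting it by \<open>hdist_eq\<close> as addition of the multiple by \<open>- 1\<close>
  leaves only operations that both structures share.\<close>

lemma (in complex_inner_space) hdist_submodule:
  assumes N: "submodule N complex_ring H" and "x \<in> N" "y \<in> N"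
  shows "hdist (H\<lparr>carrier := N\<rparr>) x y = hdist H x y"
proof -
  interpret N: complex_inner_space "H\<lparr>carrier := N\<rparr>"
    using N by (rule complex_inner_space_submodule)
  show ?thesis
    using assms(2,3) submoduleE(1)[OF N] by (simp add: hdist_eq N.hdist_eq subset_iff)
qed

text \<open>Distances in \<open>N\<close> and in \<open>H\<close> agree, so a Cauchy sequence in
  \<open>N\<close> converges in \<open>H\<close>; its limit lies in the closed set \<open>N\<close>
  and is also its limit there.\<close>

lemma (in hilbert_space) hilbert_space_closed_submodule:
  assumes N: "submodule N complex_ring H" and closed: "closedin (htopology H) N"
  shows "hilbert_space (H\<lparr>carrier := N\<rparr>)"
proof -
  interpret N: complex_inner_space "H\<lparr>carrier := N\<rparr>"
    using N by (rule complex_inner_space_submodule)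
  note sub = submoduleE(1)[OF N]
  have "N.mcomplete"
    unfolding N.mcomplete_def
  proof (intro allI impI)
    fix s :: "nat \<Rightarrow> 'a"
    assume "N.MCauchy s"
    then have s: "\<And>i. s i \<in> N"
      and "\<forall>e>0. \<exists>m. \<forall>i j. m \<le> i \<longrightarrow> m \<le> j \<longrightarrow> hdist H (s i) (s j) < e"
      unfolding N.MCauchy_def by (auto simp: image_subset_iff hdist_submodule[OF N])
    then have "MCauchy s"
      using sub by (auto simp: MCauchy_def)
    then obtain l where l: "limitin mtopology s l sequentially"
      using complete by (auto simp: mcomplete_def)
    then have "l \<in> N"
      using closed s by (intro limitin_closedin[OF l]) (auto simp: htopology_def)
    moreover have "\<forall>e>0. \<forall>\<^sub>F i in sequentially. hdist (H\<lparr>carrier := N\<rparr>) (s i) l < e"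
      using l s \<open>l \<in> N\<close> by (simp add: limitin_metric hdist_submodule[OF N] eventually_conj_iff)
    ultimately show "\<exists>l. limitin N.mtopology s l sequentially"
      unfolding N.limitin_metric using s by auto
  qed
  then show ?thesis
    by (intro hilbert_space.intro N.complex_inner_space_axioms hilbert_space_axioms.intro)
qed


section \<open>Restriction of operators\<close>

lemma bounded_ops_mem: "F \<in> bounded_ops H K \<Longrightarrow> x \<in> carrier H \<Longrightarrow> F x \<in> carrier K"
  by (auto simp: bounded_ops_def)

text \<open>Extensionality concerns only the domain and the norm ignores the carrier, so the same
  function serves as an operator into \<open>K\<close> and into a subspace containing its range. No
  inclusion map is introduced.\<close>

lemma bounded_ops_range_restrict:
  assumes "F \<in> bounded_ops H K" "F ` carrier H \<subseteq> N"
  shows "F \<in> bounded_ops H (K\<lparr>carrier := N\<rparr>)"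
  using assms by (auto simp: bounded_ops_def PiE_iff)

lemma bounded_ops_range_extend:
  assumes "F \<in> bounded_ops H (K\<lparr>carrier := N\<rparr>)" "N \<subseteq> carrier K"
  shows "F \<in> bounded_ops H K"
  using assms by (auto simp: bounded_ops_def PiE_iff)

lemma (in complex_inner_space) bounded_ops_restrict:
  assumes N: "submodule N complex_ring H"
    and "F \<in> bounded_ops H H" and "\<And>x. x \<in> N \<Longrightarrow> F x \<in> N"
  shows "restrict F N \<in> bounded_ops (H\<lparr>carrier := N\<rparr>) (H\<lparr>carrier := N\<rparr>)"
proof -
  obtain C where "\<forall>x\<in>carrier H. hnorm H (F x) \<le> C * hnorm H x"
    using assms(2) unfolding bounded_ops_def by blast
  then have "\<exists>C. \<forall>x\<in>N. hnorm H (F x) \<le> C * hnorm H x"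
    using submoduleE(1)[OF N] by blast
  then show ?thesis
    using assms(2,3) submoduleE(1)[OF N]
    by (auto simp: bounded_ops_def subset_iff submodule_smult[OF N] submoduleE(5)[OF N])
qed

lemma (in complex_inner_space) id_bounded_op: "(\<lambda>x\<in>carrier H. x) \<in> bounded_ops H H"
  by (auto simp: bounded_ops_def intro!: exI[of _ 1])

lemma compose_eq_iff:
  "compose A g f = compose A g' f' \<longleftrightarrow> (\<forall>x\<in>A. g (f x) = g' (f' x))"
  by (auto simp: compose_def fun_eq_iff restrict_def)

lemma compose_eq_id_iff: "compose A g f = (\<lambda>x\<in>A. x) \<longleftrightarrow> (\<forall>x\<in>A. g (f x) = x)"
  by (auto simp: compose_def fun_eq_iff restrict_def)

text \<open>The adjoint and inverse of the restriction is the restriction of \<open>G\<close>, which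
  is why \<open>N\<close> must be invariant under both operators. The bilateral shift restricted to
  a subspace invariant only under itself can fail to be onto.\<close>

lemma (in complex_inner_space) unitary_op_restrict:
  assumes N: "submodule N complex_ring H"
    and "F \<in> bounded_ops H H" "G \<in> bounded_ops H H"
    and "\<And>x. x \<in> N \<Longrightarrow> F x \<in> N" "\<And>x. x \<in> N \<Longrightarrow> G x \<in> N"
    and "\<forall>x\<in>carrier H. \<forall>y\<in>carrier H. cinner H (F x) y = cinner H x (G y)"
    and "compose (carrier H) G F = (\<lambda>x\<in>carrier H. x)"
    and "compose (carrier H) F G = (\<lambda>x\<in>carrier H. x)"
  shows "unitary_op (H\<lparr>carrier := N\<rparr>) (restrict F N)"
  unfolding unitary_op_def
proof (intro conjI bexI[of _ "restrict G N"])
  show "restrict F N \<in> bounded_ops (H\<lparr>carrier := N\<rparr>) (H\<lparr>carrier := N\<rparr>)"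
    "restrict G N \<in> bounded_ops (H\<lparr>carrier := N\<rparr>) (H\<lparr>carrier := N\<rparr>)"
    using assms by (auto intro: bounded_ops_restrict)
qed (use assms submoduleE(1)[OF N] in \<open>auto simp: compose_eq_id_iff subset_iff\<close>)


section \<open>The span of the orbit\<close>

lemma unitary_opE:
  assumes "unitary_op K U"
  obtains V where "U \<in> bounded_ops K K" "V \<in> bounded_ops K K"
    "\<forall>x\<in>carrier K. \<forall>y\<in>carrier K. cinner K (U x) y = cinner K x (V y)"
    "compose (carrier K) V U = (\<lambda>x\<in>carrier K. x)"
    "compose (carrier K) U V = (\<lambda>x\<in>carrier K. x)"
  using assms by (auto simp: unitary_op_def)

section \<open>Unitary operators and their powers in the group of bijections\<close>

lemma unitary_op_Bij:
  assumes "unitary_op K U"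
  shows "U \<in> Bij (carrier K)"
proof -
  obtain V where "U \<in> bounded_ops K K" "V \<in> bounded_ops K K"
    "compose (carrier K) V U = (\<lambda>x\<in>carrier K. x)"
    "compose (carrier K) U V = (\<lambda>x\<in>carrier K. x)"
    using assms by (rule unitary_opE)
  then show ?thesis
    unfolding Bij_def compose_eq_id_iff
    by (auto simp: bounded_ops_def PiE_iff intro!: bij_betwI[of _ _ _ V])
qed

lemma carrier_BijGroup: "carrier (BijGroup S) = Bij S"
  by (simp add: BijGroup_def)

lemma mult_BijGroup: "f \<in> Bij S \<Longrightarrow> g \<in> Bij S \<Longrightarrow> f \<otimes>\<^bsub>BijGroup S\<^esub> g = compose S f g"
  by (simp add: BijGroup_def)

text \<open>This serves to identify the group inverse of a unitary operator, which occurs in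
  negative powers, with its adjoint, which is known to be bounded.\<close>

lemma inv_BijGroup_eq:
  assumes "f \<in> Bij S" "g \<in> extensional S" "g \<in> S \<rightarrow> S"
    and "compose S g f = (\<lambda>x\<in>S. x)" "compose S f g = (\<lambda>x\<in>S. x)"
  shows "inv\<^bsub>BijGroup S\<^esub> f = g"
proof -
  interpret group "BijGroup S"
    by (rule group_BijGroup)
  have "f \<in> S \<rightarrow> S"
    using assms(1) by (rule Bij_imp_funcset)
  then have "g \<in> Bij S"
    using assms(2-5) by (auto simp: Bij_def compose_eq_id_iff intro!: bij_betwI[of _ _ _ f])
  then show ?thesis
    using assms(1,4) by (intro inv_equality) (simp_all add: carrier_BijGroup mult_BijGroup, simp add: BijGroup_def)
qed

lemma multi_power_Bij:
  assumes "\<forall>i\<in>{1..n}. unitary_op K (U i)"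
  shows "multi_power n K U k \<in> Bij (carrier K)"
proof -
  interpret group "BijGroup (carrier K)"
    by (rule group_BijGroup)
  have "multi_power n K U k \<in> carrier (BijGroup (carrier K))"
    unfolding multi_power_def using assms
    by (intro foldr_int_pow_closed) (auto simp: carrier_BijGroup intro: unitary_op_Bij)
  then show ?thesis
    by (simp only: carrier_BijGroup)
qed

lemma multi_power_update:
  assumes U: "\<forall>i\<in>{1..n}. unitary_op K (U i)" and comm: "commuting_tuple n K U"
    and i: "i \<in> {1..n}"
  shows "multi_power n K U (k(i := k i + e)) =
    compose (carrier K) (U i [^]\<^bsub>BijGroup (carrier K)\<^esub> e) (multi_power n K U k)"
proof -
  interpret group "BijGroup (carrier K)"
    by (rule group_BijGroup)
  have Bij: "U j \<in> carrier (BijGroup (carrier K))" if "j \<in> {1..n}" for j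
    using unitary_op_Bij[OF bspec[OF U that]] by (simp only: carrier_BijGroup)
  have "multi_power n K U (k(i := k i + e)) =
      U i [^]\<^bsub>BijGroup (carrier K)\<^esub> e \<otimes>\<^bsub>BijGroup (carrier K)\<^esub> multi_power n K U k"
    unfolding multi_power_def
  proof (rule foldr_int_pow_update)
    show "U i \<otimes>\<^bsub>BijGroup (carrier K)\<^esub> U j = U j \<otimes>\<^bsub>BijGroup (carrier K)\<^esub> U i"
      if "j \<in> set [1..<Suc n]" for j
      using that comm i Bij[of i] Bij[of j] by (auto simp: carrier_BijGroup mult_BijGroup commuting_tuple_def)
  qed (use i Bij in auto)
  moreover have "U i [^]\<^bsub>BijGroup (carrier K)\<^esub> e \<in> Bij (carrier K)"
    using int_pow_closed[OF Bij[OF i], of e] by (simp only: carrier_BijGroup)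
  ultimately show ?thesis
    using multi_power_Bij[OF U, of k] by (simp add: mult_BijGroup)
qed

section \<open>The orbit of the range of \<open>X\<close> and its closed linear span\<close>

definition orbit ::
    "nat \<Rightarrow> 'a hilbert_structure \<Rightarrow> 'b hilbert_structure \<Rightarrow> ('a \<Rightarrow> 'b) \<Rightarrow> (nat \<Rightarrow> 'b \<Rightarrow> 'b) \<Rightarrow> 'b set"
  where "orbit n H K X U = (\<Union>k. multi_power n K U k ` X ` carrier H)"

lemma orbit_subset:
  assumes "\<forall>i\<in>{1..n}. unitary_op K (U i)" "X \<in> bounded_ops H K"
  shows "orbit n H K X U \<subseteq> carrier K"
  using Bij_imp_funcset[OF multi_power_Bij[OF assms(1)]] bounded_ops_mem[OF assms(2)]
  by (fastforce simp: orbit_def)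

lemma range_subset_orbit:
  assumes "X \<in> bounded_ops H K"
  shows "X ` carrier H \<subseteq> orbit n H K X U"
proof -
  interpret group "BijGroup (carrier K)"
    by (rule group_BijGroup)
  have "foldr (\<lambda>i v. \<one>\<^bsub>BijGroup (carrier K)\<^esub> \<otimes>\<^bsub>BijGroup (carrier K)\<^esub> v) js
      \<one>\<^bsub>BijGroup (carrier K)\<^esub> = \<one>\<^bsub>BijGroup (carrier K)\<^esub>" for js :: "nat list"
    by (induction js) auto
  \<comment> \<open>With all exponents zero the product consists of group units, and the unit is the
    identity restricted to the carrier.\<close>
  then have "multi_power n K U (\<lambda>_. 0) = (\<lambda>x\<in>carrier K. x)"
    by (simp add: multi_power_def del: upt_Suc) (simp add: BijGroup_def)
  then have "X x = multi_power n K U (\<lambda>_. 0) (X x)" if "x \<in> carrier H" for x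
    using bounded_ops_mem[OF assms that] by simp
  then show ?thesis
    unfolding orbit_def by blast
qed

text \<open>Applying \<open>U i\<close> to the power \<open>e\<close> merely replaces the exponent
  \<open>k i\<close> by \<open>k i + e\<close>, and the orbit runs over all exponents.\<close>

lemma orbit_int_pow:
  assumes U: "\<forall>i\<in>{1..n}. unitary_op K (U i)" and comm: "commuting_tuple n K U"
    and X: "X \<in> bounded_ops H K" and i: "i \<in> {1..n}" and y: "y \<in> orbit n H K X U"
  shows "(U i [^]\<^bsub>BijGroup (carrier K)\<^esub> (e::int)) y \<in> orbit n H K X U"
proof -
  obtain k x where x: "x \<in> carrier H" and y: "y = multi_power n K U k (X x)"
    using y by (auto simp: orbit_def)
  have "(U i [^]\<^bsub>BijGroup (carrier K)\<^esub> e) y = multi_power n K U (k(i := k i + e)) (X x)"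
    using bounded_ops_mem[OF X x] by (simp only: y multi_power_update[OF U comm i] compose_eq)
  then show ?thesis
    using x by (auto simp: orbit_def)
qed

text \<open>The orbit is invariant under \<open>U i\<close> (exponent 1) and under its inverse
  \<open>V\<close> (exponent -1). Both are bounded operators, so the closed linear span inherits the
  invariance.\<close>

lemma closed_linear_span_orbit_reducing:
  assumes K: "complex_inner_space K"
    and U: "\<forall>i\<in>{1..n}. unitary_op K (U i)" and comm: "commuting_tuple n K U"
    and X: "X \<in> bounded_ops H K" and i: "i \<in> {1..n}"
    and V: "V \<in> bounded_ops K K" "compose (carrier K) V (U i) = (\<lambda>x\<in>carrier K. x)"
      "compose (carrier K) (U i) V = (\<lambda>x\<in>carrier K. x)"
    and y: "y \<in> closed_linear_span K (orbit n H K X U)"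
  shows "U i y \<in> closed_linear_span K (orbit n H K X U)"
    and "V y \<in> closed_linear_span K (orbit n H K X U)"
proof -
  interpret K: complex_inner_space K
    by (rule K)
  interpret group "BijGroup (carrier K)"
    by (rule group_BijGroup)
  have Bij: "U i \<in> Bij (carrier K)"
    using bspec[OF U i] by (rule unitary_op_Bij)
  then have carr: "U i \<in> carrier (BijGroup (carrier K))"
    by (simp only: carrier_BijGroup)
  note S = orbit_subset[OF U X]
  have "U i ` orbit n H K X U \<subseteq> orbit n H K X U"
    using orbit_int_pow[OF U comm X i, of _ 1] carr by auto
  then show "U i y \<in> closed_linear_span K (orbit n H K X U)"
    using K.closed_linear_span_bounded_op[OF S _ _ y] bspec[OF U i] by (auto simp: unitary_op_def)
  have "inv\<^bsub>BijGroup (carrier K)\<^esub> (U i) = V"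
    using V Bij by (intro inv_BijGroup_eq) (auto simp: bounded_ops_def PiE_iff)
  then have "V ` orbit n H K X U \<subseteq> orbit n H K X U"
    using orbit_int_pow[OF U comm X i, of _ "- 1"] carr by (auto simp: int_pow_neg)
  then show "V y \<in> closed_linear_span K (orbit n H K X U)"
    using K.closed_linear_span_bounded_op[OF S V(1) _ y] by auto
qed

text \<open>This is the competing pair for the universal property. Its space is \<open>K\<close>
  with a smaller carrier, hence lives on the same type, as \<open>unitary_asymptote\<close> requires
  of the spaces it quantifies over.\<close>

lemma unitary_intertwining_pair_span:
  assumes "unitary_intertwining_pair n H T K X U"
  defines "L \<equiv> closed_linear_span K (orbit n H K X U)"
  shows "unitary_intertwining_pair n H T (K\<lparr>carrier := L\<rparr>) X (\<lambda>i. restrict (U i) L)"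
proof -
  have hilbert: "hilbert_space K" and comm: "commuting_tuple n K U"
    and U: "\<forall>i\<in>{1..n}. unitary_op K (U i)"
    and X: "X \<in> bounded_ops H K"
    and XT: "\<And>i x. i \<in> {1..n} \<Longrightarrow> x \<in> carrier H \<Longrightarrow> X (T i x) = U i (X x)"
    using assms(1) by (auto simp: unitary_intertwining_pair_def intertwiners_def compose_eq_iff)
  interpret K: hilbert_space K
    by (rule hilbert)
  have S: "orbit n H K X U \<subseteq> carrier K"
    by (rule orbit_subset[OF U X])
  have L: "submodule L complex_ring K"
    unfolding L_def by (rule K.submodule_closed_linear_span[OF S])
  have sub: "L \<subseteq> carrier K"
    by (rule K.submoduleE(1)[OF L])
  have XL: "X ` carrier H \<subseteq> L"
    using range_subset_orbit[OF X] K.closed_linear_span_superset[OF S] unfolding L_def by blast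
  have unitary: "unitary_op (K\<lparr>carrier := L\<rparr>) (restrict (U i) L)" and UL: "\<And>y. y \<in> L \<Longrightarrow> U i y \<in> L"
    if i: "i \<in> {1..n}" for i
  proof -
    obtain V where V: "U i \<in> bounded_ops K K" "V \<in> bounded_ops K K"
      "\<forall>x\<in>carrier K. \<forall>y\<in>carrier K. cinner K (U i x) y = cinner K x (V y)"
      "compose (carrier K) V (U i) = (\<lambda>x\<in>carrier K. x)"
      "compose (carrier K) (U i) V = (\<lambda>x\<in>carrier K. x)"
      using bspec[OF U i] by (rule unitary_opE)
    note red = closed_linear_span_orbit_reducing[OF K.complex_inner_space_axioms U comm X i
        V(2,4,5), folded L_def]
    show "unitary_op (K\<lparr>carrier := L\<rparr>) (restrict (U i) L)"
      using L V(1,2) red V(3-5) by (rule K.unitary_op_restrict)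
    show "\<And>y. y \<in> L \<Longrightarrow> U i y \<in> L"
      by (rule red(1))
  qed
  \<comment> \<open>By the invariance \<open>UL\<close> the restrictions act as the operators
    themselves inside compositions, so commutation is inherited from \<open>K\<close>.\<close>
  have "commuting_tuple n (K\<lparr>carrier := L\<rparr>) (\<lambda>i. restrict (U i) L)"
    using comm unitary UL sub
    by (auto simp: commuting_tuple_def compose_eq_iff unitary_op_def subset_iff)
  moreover have "X \<in> intertwiners n H T (K\<lparr>carrier := L\<rparr>) (\<lambda>i. restrict (U i) L)"
    using bounded_ops_range_restrict[OF X XL] XT XL
    by (auto simp: intertwiners_def compose_eq_iff)
  moreover have "hilbert_space (K\<lparr>carrier := L\<rparr>)"
    using L K.closedin_closed_linear_span unfolding L_def
    by (rule K.hilbert_space_closed_submodule)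
  ultimately show ?thesis
    using unitary by (auto simp: unitary_intertwining_pair_def)
qed

theorem proposition1:
  fixes n :: nat
    and H :: "'h hilbert_structure" and T :: "nat \<Rightarrow> 'h \<Rightarrow> 'h"
    and K :: "'k hilbert_structure" and X :: "'h \<Rightarrow> 'k" and U :: "nat \<Rightarrow> 'k \<Rightarrow> 'k"
  assumes "hilbert_space H"
    and "separable_space (htopology H)"
    and "commuting_tuple n H T"
    and "unitary_asymptote n H T K X U"
  shows "minimal_pair n H K X U"
proof -
  define L where "L = closed_linear_span K (orbit n H K X U)"
  have pair: "unitary_intertwining_pair n H T K X U"
    using assms(4) by (simp add: unitary_asymptote_def)
  then have X: "X \<in> bounded_ops H K" and U: "\<forall>i\<in>{1..n}. unitary_op K (U i)"
    by (auto simp: unitary_intertwining_pair_def intertwiners_def)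
  interpret K: hilbert_space K
    using pair by (simp add: unitary_intertwining_pair_def)
  have sub: "L \<subseteq> carrier K"
    unfolding L_def
    by (intro K.submoduleE(1) K.submodule_closed_linear_span orbit_subset[OF U X])
  obtain Y where Y: "Y \<in> intertwiners n K U (K\<lparr>carrier := L\<rparr>) (\<lambda>i. restrict (U i) L)"
    and YX: "X = compose (carrier H) Y X"
    using assms(4) unitary_intertwining_pair_span[OF pair]
    unfolding unitary_asymptote_def L_def by blast
  have YL: "Y y \<in> L" if "y \<in> carrier K" for y
    using Y that bounded_ops_mem[of Y K "K\<lparr>carrier := L\<rparr>" y] by (auto simp: intertwiners_def)
  \<comment> \<open>The values of \<open>Y\<close> lie in \<open>L\<close>, where
    \<open>restrict (U i) L\<close> agrees with \<open>U i\<close>; so the same function, read as an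
    operator into \<open>K\<close>, intertwines \<open>U\<close> with itself.\<close>
  have "Y \<in> intertwiners n K U K U"
    using Y YL sub bounded_ops_range_extend[of Y K L K]
    by (auto simp: intertwiners_def compose_eq_iff)
  moreover have "(\<lambda>y\<in>carrier K. y) \<in> intertwiners n K U K U"
    using K.id_bounded_op U bounded_ops_mem[of "U _" K K]
    unfolding intertwiners_def compose_eq_iff unitary_op_def by simp
  moreover have "X = compose (carrier H) (\<lambda>y\<in>carrier K. y) X"
    using X by (intro Id_compose[symmetric]) (auto simp: bounded_ops_def PiE_iff)
  \<comment> \<open>Here the universal property is tested against the pair itself, which yields the
    uniqueness that forces \<open>Y\<close> to be the identity.\<close>
  moreover have "\<exists>!Y. Y \<in> intertwiners n K U K U \<and> X = compose (carrier H) Y X"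
    using assms(4) pair unfolding unitary_asymptote_def by blast
  ultimately have "Y = (\<lambda>y\<in>carrier K. y)"
    using YX by blast
  \<comment> \<open>Each \<open>y\<close> in the carrier equals \<open>Y y\<close>, and the values
    of \<open>Y\<close> lie in \<open>L\<close>.\<close>
  then have "carrier K \<subseteq> L"
    using YL by auto
  then show ?thesis
    using sub by (auto simp: minimal_pair_def L_def orbit_def)
qed

end
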